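(* Every Arctic auction with stepwise marginal costs in which every bid has positive value for at least one good, and in which for every good $i\in[n]$ there is a bid $j$ with $\beta^j>0$ and $r^j_i>0$, has a competitive equilibrium.
   Context: Arctic auction with stepwise marginal costs. There are goods $[n]=\{1,\dots,n\}$ and bids $(\beta^j;\mathbf r^j)$, $j\in[m]$, with budget $\beta^j\in\mathbb R_{\ge 0}$ and value vector $\mathbf r^j\in\mathbb R^n_{\ge 0}$. At prices $\mathbf p\in\mathbb R^n_{>0}$, the demand of bid $j$ is $D^j(\mathbf p)=\operatorname{argmax}\{(\mathbf r^j-\mathbf p)\cdot\mathbf x : \mathbf x\in\mathbb R^n_{\ge 0},\ \mathbf p\cdot\mathbf x\le\beta^j\}$. The auctioneer has cost $C(\mathbf y)=\sum_{i\in[n]}C_i(y_i)$, where $C_i$ has $K_i\ge 1$ steps; step $k\in[K_i]$ has width $s_{ik}>0$ and marginal cost $c_{ik}$, with $0\le c_{i1}<c_{i2}<\dots<c_{iK_i}$. With $S_{i0}=0$, $S_{ik}=\sum_{h=1}^k s_{ih}$ and $s_i=S_{iK_i}$ (the supply cap), $C_i(y_i)=\sum_{k<l}c_{ik}s_{ik}+c_{il}(y_i-S_{i,l-1})$ for $y_i\in[S_{i,l-1},S_{il}]$, and $C_i(y_i)=\infty$ for $y_i>s_i$. A competitive equilibrium consists of prices $\mathbf p\in\mathbb R^n_{>0}$ and allocations $\mathbf x^1,\dots,\mathbf x^m$ with $\mathbf x^j\in D^j(\mathbf p)$ for all $j$ and $\mathbf y=\sum_j\mathbf x^j\in\operatorname{argmax}_{\mathbf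 z\in\mathbb R^n_{\ge 0}}\{\mathbf p\cdot\mathbf z-C(\mathbf z)\}$. *)

theory Defs
  imports "HOL-Analysis.Analysis"
begin

text \<open>
  The goods are the elements of the finite type \<open>'n\<close>, bids are indexed by \<open>{1..m}\<close>, and the steps
  of good \<open>i\<close> by \<open>{1..K i}\<close>; values of \<open>\<beta>\<close>, \<open>r\<close>, \<open>s i\<close>, \<open>c i\<close> outside these ranges are irrelevant.
\<close>

locale arctic_auction =
  fixes m :: nat
    and \<beta> :: "nat \<Rightarrow> real"
    and r :: "nat \<Rightarrow> real ^ 'n"
    and K :: "'n \<Rightarrow> nat"
    and s :: "'n \<Rightarrow> nat \<Rightarrow> real"
    and c :: "'n \<Rightarrow> nat \<Rightarrow> real"
  assumes budget_nonneg: "\<And>j. j \<in> {1..m} \<Longrightarrow> 0 \<le> \<beta> j"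
    and value_nonneg: "\<And>j i. j \<in> {1..m} \<Longrightarrow> 0 \<le> r j $ i"
    and steps_pos: "\<And>i. 1 \<le> K i"
    and width_pos: "\<And>i k. k \<in> {1..K i} \<Longrightarrow> 0 < s i k"
    and marginal_nonneg: "\<And>i. 0 \<le> c i 1"
    and marginal_increasing: "\<And>i. strict_mono_on {1..K i} (c i)"

definition demand :: "real \<Rightarrow> real ^ 'n \<Rightarrow> real ^ 'n \<Rightarrow> (real ^ 'n) set" where
  "demand b v p =
     {x. is_arg_max (\<lambda>x. (v - p) \<bullet> x) (\<lambda>x. (\<forall>i. 0 \<le> x $ i) \<and> p \<bullet> x \<le> b) x}"

definition cum_width :: "(nat \<Rightarrow> real) \<Rightarrow> nat \<Rightarrow> real" where
  "cum_width w k = (\<Sum>h=1..k. w h)"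

text \<open>
  The step \<open>l\<close> containing \<open>y\<close> is not unique at a breakpoint, where both candidates give the same
  cost; the definition picks the smallest one. The lemma below is the defining formula for every
  admissible \<open>l\<close>. Only arguments \<open>y \<ge> 0\<close> are meaningful.
\<close>

definition step_cost :: "nat \<Rightarrow> (nat \<Rightarrow> real) \<Rightarrow> (nat \<Rightarrow> real) \<Rightarrow> real \<Rightarrow> ereal" where
  "step_cost N w d y =
     (if y > cum_width w N then \<infinity>
      else let l = (LEAST l. 1 \<le> l \<and> y \<le> cum_width w l)
           in ereal ((\<Sum>k=1..<l. d k * w k) + d l * (y - cum_width w (l - 1))))"

lemma cum_width_mono:
  assumes "\<And>k. k \<in> {1..N} \<Longrightarrow> 0 < w k" "a \<le> b" "b \<le> N"
  shows "cum_width w a \<le> cum_width w b"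
  unfolding cum_width_def using assms
  by (intro sum_mono2) (auto simp: less_imp_le)

lemma cum_width_less:
  assumes "\<And>k. k \<in> {1..N} \<Longrightarrow> 0 < w k" "a < b" "b \<le> N"
  shows "cum_width w a < cum_width w b"
proof -
  obtain b' where b: "b = Suc b'" using \<open>a < b\<close> by (cases b) auto
  have "cum_width w a \<le> cum_width w b'"
    using assms b by (intro cum_width_mono[of N]) auto
  also have "\<dots> < cum_width w b"
    using assms b by (simp add: cum_width_def)
  finally show ?thesis .
qed

lemma step_cost_eq:
  assumes pos: "\<And>k. k \<in> {1..N} \<Longrightarrow> 0 < w k"
    and l: "l \<in> {1..N}"
    and y: "y \<in> {cum_width w (l - 1)..cum_width w l}"
  shows "step_cost N w d y =
           ereal ((\<Sum>k=1..<l. d k * w k) + d l * (y - cum_width w (l - 1)))"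
proof -
  define q where "q = (LEAST l. 1 \<le> l \<and> y \<le> cum_width w l)"
  have q: "1 \<le> q \<and> y \<le> cum_width w q" and ql: "q \<le> l"
    unfolding q_def using l y by (auto intro: LeastI2 Least_le)
  have le: "\<not> y > cum_width w N"
    using cum_width_mono[of N w l N] pos l y by auto
  have cost: "step_cost N w d y =
      ereal ((\<Sum>k=1..<q. d k * w k) + d q * (y - cum_width w (q - 1)))"
    using le by (simp add: step_cost_def q_def Let_def)
  show ?thesis
  proof (cases "q = l")
    case True
    then show ?thesis using cost by simp
  next
    case False
    have "\<not> q < l - 1"
      using cum_width_less[of N w q "l - 1"] pos l y q by fastforce
    then have lq: "l = Suc q" using False ql by auto
    then have yq: "y = cum_width w q" using y q by auto
    obtain q' where q': "q = Suc q'" using q by (cases q) auto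
    have "cum_width w q - cum_width w (q - 1) = w q"
      by (simp add: cum_width_def q')
    then show ?thesis
      using cost lq yq q by (simp add: algebra_simps)
  qed
qed

definition total_cost ::
  "('n \<Rightarrow> nat) \<Rightarrow> ('n \<Rightarrow> nat \<Rightarrow> real) \<Rightarrow> ('n \<Rightarrow> nat \<Rightarrow> real) \<Rightarrow> real ^ 'n \<Rightarrow> ereal" where
  "total_cost K s c y = (\<Sum>i\<in>UNIV. step_cost (K i) (s i) (c i) (y $ i))"

definition competitive_equilibrium ::
  "nat \<Rightarrow> (nat \<Rightarrow> real) \<Rightarrow> (nat \<Rightarrow> real ^ 'n) \<Rightarrow>
   ('n \<Rightarrow> nat) \<Rightarrow> ('n \<Rightarrow> nat \<Rightarrow> real) \<Rightarrow> ('n \<Rightarrow> nat \<Rightarrow> real) \<Rightarrow>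
   real ^ 'n \<Rightarrow> (nat \<Rightarrow> real ^ 'n) \<Rightarrow> bool" where
  "competitive_equilibrium m \<beta> r K s c p x \<longleftrightarrow>
     (\<forall>i. 0 < p $ i) \<and>
     (\<forall>j\<in>{1..m}. x j \<in> demand (\<beta> j) (r j) p) \<and>
     is_arg_max (\<lambda>z. ereal (p \<bullet> z) - total_cost K s c z) (\<lambda>z. \<forall>i. 0 \<le> z $ i) (\<Sum>j=1..m. x j)"

end

theory Submission
  imports Defs
begin

text \<open>
  Discard the bids with budget 0. For the others, an equilibrium is obtained from a maximiser of the
  concave programme \<open>\<Sum>j. \<phi>\<^sub>j (r\<^sup>j \<bullet> x\<^sup>j) - C (\<Sum>j. x\<^sup>j)\<close>, where
  \<open>\<phi>\<^sub>j w = max {\<beta>\<^sup>j ln (w + \<delta>) - \<delta> | \<delta> \<ge> 0}\<close>; this is the Eisenberg--Gale objective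
  for bidders who may keep an amount \<open>\<delta>\<close> of their budget. Put
  \<open>\<lambda>\<^sub>j = \<phi>\<^sub>j' (r\<^sup>j \<bullet> x\<^sup>j)\<close> and \<open>p\<^sub>i = max\<^sub>j \<lambda>\<^sub>j r\<^sup>j\<^sub>i\<close>. Since \<open>C\<close> is convex, the maximiser also
  maximises the objective in which every \<open>\<phi>\<^sub>j\<close> is replaced by its linearisation. Comparing it with
  the allocation that gives \<open>z\<^sub>i\<close> units of each good \<open>i\<close> to a bid attaining \<open>p\<^sub>i\<close> shows that \<open>\<Sum>j. x\<^sup>j\<close>
  is an optimal supply, and, for \<open>z = \<Sum>j. x\<^sup>j\<close>, that good \<open>i\<close> is sold only to bids attaining \<open>p\<^sub>i\<close>,
  that is, to bids for which \<open>i\<close> has maximal value per unit of money.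
\<close>

section \<open>Stepwise costs as maxima of affine functions\<close>

text \<open>The cost formula of step \<open>l\<close>, extended as an affine function to the whole
  line.\<close>

definition cost_piece :: "(nat \<Rightarrow> real) \<Rightarrow> (nat \<Rightarrow> real) \<Rightarrow> nat \<Rightarrow> real \<Rightarrow> real" where
  "cost_piece w d l y = (\<Sum>k=1..<l. d k * w k) + d l * (y - cum_width w (l - 1))"

lemma cost_piece_Suc:
  assumes "1 \<le> l"
  shows "cost_piece w d (Suc l) y - cost_piece w d l y = (d (Suc l) - d l) * (y - cum_width w l)"
proof -
  obtain l' where l': "l = Suc l'" using assms by (cases l) auto
  show ?thesis
    by (simp add: cost_piece_def cum_width_def l' algebra_simps)
qed

text \<open>By \<open>cost_piece_Suc\<close>, the pieces \<open>k\<close> and \<open>Suc k\<close>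
  cross at the breakpoint \<open>cum_width w k\<close>. Breakpoints with index below
  \<open>q\<close> are at most \<open>y\<close> and the later ones at least \<open>y\<close>, so no
  move away from \<open>q\<close> raises the value.\<close>

lemma cost_piece_le:
  assumes pos: "\<And>k. k \<in> {1..N} \<Longrightarrow> 0 < w k" and mono: "mono_on {1..N} d"
    and q: "q \<in> {1..N}" and y: "y \<in> {cum_width w (q - 1)..cum_width w q}" and l: "l \<in> {1..N}"
  shows "cost_piece w d l y \<le> cost_piece w d q y"
proof (cases "l \<le> q")
  case True
  from True l show ?thesis
  proof (induction l rule: inc_induct)
    case base
    then show ?case by simp
  next
    case (step k)
    then have k: "k \<in> {1..N}" "Suc k \<in> {1..N}" "d k \<le> d (Suc k)"
      using q by (auto intro!: mono_onD[OF mono])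
    have "cum_width w k \<le> cum_width w (q - 1)"
      using step.hyps q by (intro cum_width_mono[of N, OF pos]) auto
    then have "0 \<le> (d (Suc k) - d k) * (y - cum_width w k)"
      using k y by (intro mult_nonneg_nonneg) auto
    then have "cost_piece w d k y \<le> cost_piece w d (Suc k) y"
      using cost_piece_Suc[of k w d y] k by simp
    also have "\<dots> \<le> cost_piece w d q y"
      using step.IH k by blast
    finally show ?case .
  qed
next
  case False
  then have "q \<le> l" by simp
  from this l show ?thesis
  proof (induction l rule: dec_induct)
    case base
    then show ?case by simp
  next
    case (step k)
    then have k: "k \<in> {1..N}" "Suc k \<in> {1..N}" "d k \<le> d (Suc k)"
      using q by (auto intro!: mono_onD[OF mono])
    have "cum_width w q \<le> cum_width w k"
      using step.hyps k by (intro cum_width_mono[of N, OF pos]) auto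
    then have "(d (Suc k) - d k) * (y - cum_width w k) \<le> 0"
      using k y by (intro mult_nonneg_nonpos) auto
    then have "cost_piece w d (Suc k) y \<le> cost_piece w d k y"
      using cost_piece_Suc[of k w d y] k by simp
    also have "\<dots> \<le> cost_piece w d q y"
      using step.IH k by blast
    finally show ?case .
  qed
qed

lemma step_cost_piece:
  assumes pos: "\<And>k. k \<in> {1..N} \<Longrightarrow> 0 < w k" and mono: "mono_on {1..N} d" and N: "1 \<le> N"
    and y: "y \<in> {0..cum_width w N}"
  obtains q where "q \<in> {1..N}" "step_cost N w d y = ereal (cost_piece w d q y)"
    "\<And>l. l \<in> {1..N} \<Longrightarrow> cost_piece w d l y \<le> cost_piece w d q y"
proof -
  let ?P = "\<lambda>l. 1 \<le> l \<and> y \<le> cum_width w l"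
  define q where "q = (LEAST l. ?P l)"
  have P_N: "?P N" using N y by simp
  have q: "?P q" "q \<le> N"
    unfolding q_def by (rule LeastI[of ?P, OF P_N], rule Least_le[of ?P, OF P_N])
  have "cum_width w (q - 1) \<le> y"
  proof (cases "q = 1")
    case True
    then show ?thesis using y by (simp add: cum_width_def)
  next
    case False
    then have "\<not> ?P (q - 1)"
      by (intro not_less_Least[of "q - 1" ?P, folded q_def]) (use q in simp)
    then show ?thesis using False q by auto
  qed
  then have yq: "y \<in> {cum_width w (q - 1)..cum_width w q}" and q': "q \<in> {1..N}"
    using q by auto
  show thesis
    using that[of q] q' step_cost_eq[OF pos q' yq] cost_piece_le[OF pos mono q' yq]
    by (auto simp: cost_piece_def)
qed

text \<open>Convex analysis is done with real values. Beyond the cap \<open>real_of_ereal\<close>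
  turns the infinite cost into 0, so the facts below are confined to
  \<open>{0..cum_width w N}\<close>.\<close>

definition real_step_cost :: "nat \<Rightarrow> (nat \<Rightarrow> real) \<Rightarrow> (nat \<Rightarrow> real) \<Rightarrow> real \<Rightarrow> real" where
  "real_step_cost N w d y = real_of_ereal (step_cost N w d y)"

context
  fixes N :: nat and w d :: "nat \<Rightarrow> real"
  assumes pos: "\<And>k. k \<in> {1..N} \<Longrightarrow> 0 < w k" and mono: "mono_on {1..N} d" and N: "1 \<le> N"
begin

lemma step_cost_eq_real:
  assumes "y \<in> {0..cum_width w N}"
  shows "step_cost N w d y = ereal (real_step_cost N w d y)"
  using step_cost_piece[OF pos mono N assms] by (metis real_of_ereal.simps(1) real_step_cost_def)

lemma real_step_cost_piece:
  assumes y: "y \<in> {0..cum_width w N}"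
  obtains q where "q \<in> {1..N}" "real_step_cost N w d y = cost_piece w d q y"
    "\<And>l. l \<in> {1..N} \<Longrightarrow> cost_piece w d l y \<le> real_step_cost N w d y"
  using step_cost_piece[OF pos mono N y] by (metis real_of_ereal.simps(1) real_step_cost_def)

text \<open>The piece active at the convex combination is affine and lies below the cost at both end
  points.\<close>

lemma convex_on_real_step_cost: "convex_on {0..cum_width w N} (real_step_cost N w d)"
proof (rule convex_onI)
  fix t x y :: real
  assume t: "0 < t" "t < 1" and x: "x \<in> {0..cum_width w N}" and y: "y \<in> {0..cum_width w N}"
  let ?z = "(1 - t) *\<^sub>R x + t *\<^sub>R y"
  have z: "?z \<in> {0..cum_width w N}"
    using t x y convexD_alt[of "{0..cum_width w N}" x y t] by auto
  obtain q where q: "q \<in> {1..N}" "real_step_cost N w d ?z = cost_piece w d q ?z"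
    using real_step_cost_piece[OF z] by metis
  have "cost_piece w d q ?z = (1 - t) * cost_piece w d q x + t * cost_piece w d q y"
    by (simp add: cost_piece_def algebra_simps)
  also have "\<dots> \<le> (1 - t) * real_step_cost N w d x + t * real_step_cost N w d y"
    using real_step_cost_piece[OF x] real_step_cost_piece[OF y] q(1) t
    by (intro add_mono mult_left_mono) (metis less_eq_real_def diff_ge_0_iff_ge)+
  finally show "real_step_cost N w d ?z \<le> (1 - t) * real_step_cost N w d x + t * real_step_cost N w d y"
    using q by simp
qed auto

lemma continuous_on_real_step_cost: "continuous_on {0..cum_width w N} (real_step_cost N w d)"
proof -
  \<comment> \<open>\<open>L\<close> dominates the slope of every piece; the piece active at
    \<open>x\<close> then bounds the one-sided difference.\<close>
  define L where "L = (\<Sum>k=1..N. \<bar>d k\<bar>)"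
  have L: "real_step_cost N w d x - real_step_cost N w d y \<le> L * \<bar>x - y\<bar>"
    if x: "x \<in> {0..cum_width w N}" and y: "y \<in> {0..cum_width w N}" for x y
  proof -
    obtain q where q: "q \<in> {1..N}" "real_step_cost N w d x = cost_piece w d q x"
      using real_step_cost_piece[OF x] by metis
    have "cost_piece w d q y \<le> real_step_cost N w d y"
      using real_step_cost_piece[OF y] q by metis
    then have "real_step_cost N w d x - real_step_cost N w d y \<le> d q * (x - y)"
      using q by (simp add: cost_piece_def algebra_simps)
    also have "\<dots> \<le> \<bar>d q\<bar> * \<bar>x - y\<bar>"
      by (metis abs_ge_self abs_mult)
    also have "\<dots> \<le> L * \<bar>x - y\<bar>"
      unfolding L_def using q by (intro mult_right_mono member_le_sum) auto
    finally show ?thesis .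
  qed
  have "L-lipschitz_on {0..cum_width w N} (real_step_cost N w d)"
  proof (rule lipschitz_onI)
    fix x y assume "x \<in> {0..cum_width w N}" "y \<in> {0..cum_width w N}"
    then show "dist (real_step_cost N w d x) (real_step_cost N w d y) \<le> L * dist x y"
      using L[of x y] L[of y x] by (simp add: dist_real_def abs_if split: if_splits)
  qed (simp add: L_def sum_nonneg)
  then show ?thesis by (rule lipschitz_on_continuous_on)
qed

end

section \<open>The utility of a budget-constrained bid\<close>

text \<open>A closed form of \<open>max {b ln (w + \<delta>) - \<delta> | \<delta> \<ge> 0}\<close>, attained at \<open>w + \<delta> = max b w\<close>.\<close>

definition budget_utility :: "real \<Rightarrow> real \<Rightarrow> real" where
  "budget_utility b w = b * ln (max b w) + w - max b w"

text \<open>For \<open>0 < b\<close> this is the derivative of \<open>budget_utility b\<close>: it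
  is 1 while \<open>w < b\<close>, where some budget is kept, and \<open>b / w\<close> from there
  on.\<close>

definition budget_slope :: "real \<Rightarrow> real \<Rightarrow> real" where
  "budget_slope b w = b / max b w"

lemma budget_slope_pos: "0 < b \<Longrightarrow> 0 < budget_slope b w"
  by (simp add: budget_slope_def)

lemma budget_slope_le_1: "0 < b \<Longrightarrow> budget_slope b w \<le> 1"
  by (simp add: budget_slope_def)

text \<open>The tangent to the logarithm at \<open>U\<close> handles the terms in \<open>U\<close>
  and \<open>V\<close>. The remaining linear terms compare by complementary slackness: either the
  slope \<open>a\<close> is 1 or \<open>w = U\<close>.\<close>

lemma budget_utility_supergradient:
  assumes "0 < b"
  shows "budget_utility b v \<le> budget_utility b w + budget_slope b w * (v - w)"
proof -
  define U V a where "U = max b w" and "V = max b v" and "a = b / U"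
  have U: "0 < U" "b \<le> U" and V: "0 < V" "v \<le> V"
    using assms by (auto simp: U_def V_def)
  have "ln V - ln U \<le> (V - U) / U"
    using ln_le_minus_one[of "V / U"] U V by (simp add: ln_div diff_divide_distrib)
  then have "b * (ln V - ln U) \<le> b * ((V - U) / U)"
    using assms by (intro mult_left_mono) auto
  then have "b * ln V - b * ln U \<le> a * (V - U)"
    by (simp only: a_def right_diff_distrib[symmetric] times_divide_eq_left times_divide_eq_right)
  moreover have "(v - V) * (1 - a) \<le> (w - U) * (1 - a)"
  proof (cases "U = b")
    case True
    then show ?thesis using assms by (simp add: a_def)
  next
    case False
    then have "w = U" by (auto simp: U_def)
    moreover have "0 \<le> 1 - a" using U by (simp add: a_def)
    ultimately show ?thesis
      using V by (simp add: mult_nonpos_nonneg)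
  qed
  ultimately show ?thesis
    unfolding budget_utility_def budget_slope_def U_def[symmetric] V_def[symmetric] a_def[symmetric]
    by (simp add: algebra_simps)
qed

section \<open>Linearised optimality\<close>

text \<open>Pinning the bundles outside \<open>J\<close> to 0 makes the set compact in the product
  topology over all of \<open>'b\<close>.\<close>

definition feasible_allocations :: "'b set \<Rightarrow> ('n \<Rightarrow> real) \<Rightarrow> ('b \<Rightarrow> real ^ 'n) set" where
  "feasible_allocations J cap =
     {x. (\<forall>j i. 0 \<le> x j $ i) \<and> (\<forall>j. j \<notin> J \<longrightarrow> x j = 0) \<and> (\<forall>i. (\<Sum>j\<in>J. x j $ i) \<le> cap i)}"

text \<open>The set is closed in a product of boxes and singletons, compact by Tychonoff. By
  nonnegativity, the cap on the sum also bounds each summand.\<close>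

lemma compact_feasible_allocations:
  fixes J :: "'b set" and cap :: "'n::finite \<Rightarrow> real"
  assumes "finite J"
  shows "compact (feasible_allocations J cap)"
proof -
  define S :: "'b \<Rightarrow> (real ^ 'n) set" where "S j = (if j \<in> J then cbox 0 (\<chi> i. cap i) else {0})" for j
  have "compactin (product_topology (\<lambda>_. euclidean) UNIV) (PiE UNIV S)"
    unfolding compactin_PiE by (auto simp: S_def)
  then have c: "compact (PiE UNIV S)"
    by (simp add: euclidean_product_topology)
  have "closed {x :: 'b \<Rightarrow> real ^ 'n. \<forall>i. (\<Sum>j\<in>J. x j $ i) \<le> cap i}"
    by (intro closed_Collect_all closed_Collect_le continuous_intros continuous_on_sum
        continuous_on_component continuous_on_product_coordinates)
  moreover have "feasible_allocations J cap = PiE UNIV S \<inter> {x. \<forall>i. (\<Sum>j\<in>J. x j $ i) \<le> cap i}"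
  proof -
    have "x j $ i \<le> cap i"
      if "\<forall>j i. 0 \<le> x j $ i" "\<forall>i. (\<Sum>j\<in>J. x j $ i) \<le> cap i" "j \<in> J" for x :: "'b \<Rightarrow> real ^ 'n" and i j
      using that assms member_le_sum[of j J "\<lambda>j. x j $ i"] by (meson DiffD1 order_trans)
    then show ?thesis
      unfolding feasible_allocations_def S_def
      by (auto simp: mem_box_cart PiE_def Pi_def split: if_splits) (metis order_refl zero_index)+
  qed
  ultimately show ?thesis
    using c by (simp add: compact_Int_closed)
qed

lemma convex_comb_feasible_allocations:
  assumes x: "x \<in> feasible_allocations J cap" and z: "z \<in> feasible_allocations J cap"
    and t: "0 \<le> t" "t \<le> 1"
  shows "(\<lambda>j. (1 - t) *\<^sub>R x j + t *\<^sub>R z j) \<in> feasible_allocations J cap"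
proof -
  have "(\<Sum>j\<in>J. (1 - t) * x j $ i + t * z j $ i) \<le> cap i" for i
  proof -
    have "(\<Sum>j\<in>J. (1 - t) * x j $ i + t * z j $ i)
        = (1 - t) * (\<Sum>j\<in>J. x j $ i) + t * (\<Sum>j\<in>J. z j $ i)"
      by (simp add: sum.distrib sum_distrib_left)
    also have "\<dots> \<le> cap i"
      using x z t by (intro convex_bound_le) (auto simp: feasible_allocations_def)
    finally show ?thesis .
  qed
  then show ?thesis
    using x z t by (auto simp: feasible_allocations_def)
qed

lemma feasible_allocations_sum:
  assumes "x \<in> feasible_allocations J cap"
  shows "(\<Sum>j\<in>J. x j $ i) \<in> {0..cap i}"
  using assms by (auto simp: feasible_allocations_def intro: sum_nonneg)

text \<open>Compactness yields a maximiser \<open>x\<close> of the concave objective. The inequality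
  is its first-order condition on the segment towards \<open>z\<close>; only the utilities are
  linearised, while the cost is bounded by its chord.\<close>

lemma exists_linearised_optimum:
  fixes v :: "'b \<Rightarrow> real ^ 'n" and D :: "'n \<Rightarrow> real \<Rightarrow> real"
  assumes fin: "finite J" and b: "\<And>j. j \<in> J \<Longrightarrow> 0 < b j"
    and cap: "\<And>i. 0 \<le> cap i"
    and cont: "\<And>i. continuous_on {0..cap i} (D i)"
    and conv: "\<And>i. convex_on {0..cap i} (D i)"
  obtains x where "x \<in> feasible_allocations J cap"
    "\<And>z. z \<in> feasible_allocations J cap \<Longrightarrow>
      (\<Sum>j\<in>J. budget_slope (b j) (v j \<bullet> x j) * (v j \<bullet> z j)) - (\<Sum>i\<in>UNIV. D i (\<Sum>j\<in>J. z j $ i)) \<le>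
      (\<Sum>j\<in>J. budget_slope (b j) (v j \<bullet> x j) * (v j \<bullet> x j)) - (\<Sum>i\<in>UNIV. D i (\<Sum>j\<in>J. x j $ i))"
proof -
  let ?F = "feasible_allocations J cap"
  define cost where "cost x = (\<Sum>i\<in>UNIV. D i (\<Sum>j\<in>J. x j $ i))" for x :: "'b \<Rightarrow> real ^ 'n"
  define obj where "obj x = (\<Sum>j\<in>J. budget_utility (b j) (v j \<bullet> x j)) - cost x" for x
  have "continuous_on ?F (\<lambda>x. \<Sum>j\<in>J. x j $ i)" for i
    by (intro continuous_intros continuous_on_component
        continuous_on_subset[OF continuous_on_product_coordinates]) auto
  then have "continuous_on ?F (\<lambda>x. D i (\<Sum>j\<in>J. x j $ i))" for i
    by (rule continuous_on_compose2[OF cont]) (use feasible_allocations_sum in blast)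
  moreover have nz: "max (b j) u \<noteq> 0" if "j \<in> J" for j u
    using b[OF that] by (simp add: max_def)
  ultimately have "continuous_on ?F obj"
    unfolding obj_def cost_def budget_utility_def
    by (intro continuous_intros continuous_on_max
        continuous_on_subset[OF continuous_on_product_coordinates])
      (use nz in auto)
  moreover have "?F \<noteq> {}"
    using cap by (auto simp: feasible_allocations_def intro!: exI[of _ "\<lambda>_. 0"])
  ultimately obtain x where x: "x \<in> ?F" and max: "\<And>z. z \<in> ?F \<Longrightarrow> obj z \<le> obj x"
    using continuous_attains_sup[OF compact_feasible_allocations[OF fin]] by metis
  have lin: "(\<Sum>j\<in>J. budget_slope (b j) (v j \<bullet> x j) * (v j \<bullet> z j - v j \<bullet> x j)) - (cost z - cost x) \<le> 0"
    if z: "z \<in> ?F" for z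
  proof -
    define u where "u t j = (1 - t) *\<^sub>R x j + t *\<^sub>R z j" for t :: real and j
    define S where "S t = (\<Sum>j\<in>J. budget_slope (b j) (v j \<bullet> u t j) * (v j \<bullet> z j - v j \<bullet> x j))" for t
    define g where "g t = S t - (cost z - cost x)" for t
    text \<open>The supergradient is taken at the perturbed point \<open>u t\<close>, so that only continuity of the
      slope, and no derivative, is needed in the limit \<open>t \<rightarrow> 0\<close>.\<close>
    have g: "g t \<le> 0" if t: "0 < t" "t < 1" for t
    proof -
      have ut: "u t \<in> ?F"
        unfolding u_def using convex_comb_feasible_allocations[OF x z] t by auto
      have "cost (u t) \<le> (1 - t) * cost x + t * cost z"
      proof -
        have "(\<Sum>j\<in>J. u t j $ i) = (1 - t) *\<^sub>R (\<Sum>j\<in>J. x j $ i) + t *\<^sub>R (\<Sum>j\<in>J. z j $ i)" for i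
          by (simp add: u_def sum.distrib sum_distrib_left)
        then have "D i (\<Sum>j\<in>J. u t j $ i) \<le> (1 - t) * D i (\<Sum>j\<in>J. x j $ i) + t * D i (\<Sum>j\<in>J. z j $ i)" for i
          using convex_onD[OF conv, of t "\<Sum>j\<in>J. x j $ i" i "\<Sum>j\<in>J. z j $ i"] t
            feasible_allocations_sum[OF x] feasible_allocations_sum[OF z] by auto
        then have "cost (u t) \<le> (\<Sum>i\<in>UNIV. (1 - t) * D i (\<Sum>j\<in>J. x j $ i) + t * D i (\<Sum>j\<in>J. z j $ i))"
          unfolding cost_def by (intro sum_mono)
        then show ?thesis
          by (simp add: cost_def sum.distrib sum_distrib_left)
      qed
      moreover have "(\<Sum>j\<in>J. budget_utility (b j) (v j \<bullet> x j)) \<le>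
          (\<Sum>j\<in>J. budget_utility (b j) (v j \<bullet> u t j)) - t * S t"
        unfolding S_def sum_distrib_left sum_subtractf[symmetric]
      proof (rule sum_mono)
        fix j assume "j \<in> J"
        have "v j \<bullet> x j - v j \<bullet> u t j = - t * (v j \<bullet> z j - v j \<bullet> x j)"
          by (simp add: u_def inner_add_right algebra_simps)
        then show "budget_utility (b j) (v j \<bullet> x j) \<le> budget_utility (b j) (v j \<bullet> u t j)
          - t * (budget_slope (b j) (v j \<bullet> u t j) * (v j \<bullet> z j - v j \<bullet> x j))"
          using budget_utility_supergradient[OF b[OF \<open>j \<in> J\<close>], of "v j \<bullet> x j" "v j \<bullet> u t j"]
          by (simp add: mult.left_commute)
      qed
      moreover have "obj (u t) \<le> obj x"
        using max[OF ut] .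
      \<comment> \<open>The two bounds combine to
        \<open>obj x + t * g t \<le> obj (u t)\<close>.\<close>
      ultimately have "t * g t \<le> 0"
        unfolding obj_def g_def by (simp add: algebra_simps)
      then show ?thesis
        using t by (simp add: mult_le_0_iff)
    qed
    have "continuous_on UNIV g"
      unfolding g_def S_def budget_slope_def u_def
      by (intro continuous_intros continuous_on_max) (use nz in auto)
    then have "(g \<longlongrightarrow> g 0) (at_right 0)"
      by (simp add: continuous_on_eq_continuous_within continuous_within filterlim_at_split)
    moreover have "\<forall>\<^sub>F t in at_right 0. g t \<le> 0"
      unfolding eventually_at_right_field using g by (intro exI[of _ 1]) auto
    ultimately have "g 0 \<le> 0"
      by (intro tendsto_upperbound) auto
    then show ?thesis
      by (simp add: g_def S_def u_def)
  qed
  show thesis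
  proof (rule that[OF x])
    fix z assume "z \<in> ?F"
    from lin[OF this]
    show "(\<Sum>j\<in>J. budget_slope (b j) (v j \<bullet> x j) * (v j \<bullet> z j)) - (\<Sum>i\<in>UNIV. D i (\<Sum>j\<in>J. z j $ i)) \<le>
      (\<Sum>j\<in>J. budget_slope (b j) (v j \<bullet> x j) * (v j \<bullet> x j)) - (\<Sum>i\<in>UNIV. D i (\<Sum>j\<in>J. x j $ i))"
      by (simp add: cost_def right_diff_distrib sum_subtractf)
  qed
qed

section \<open>Demand and supply\<close>

text \<open>At positive prices a zero budget affords only the zero bundle. This brings the discarded
  bids back into the equilibrium.\<close>

lemma zero_in_demand_0:
  assumes "\<And>i. 0 < p $ i"
  shows "0 \<in> demand 0 v p"
proof -
  have "z = 0" if "\<forall>i. 0 \<le> z $ i" "p \<bullet> z \<le> 0" for z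
  proof -
    have nn: "\<And>i. 0 \<le> p $ i * z $ i"
      using assms that by (simp add: less_imp_le)
    then have "(\<Sum>i\<in>UNIV. p $ i * z $ i) = 0"
      using that by (intro antisym sum_nonneg) (auto simp: inner_vec_def)
    then have "\<And>i. p $ i * z $ i = 0"
      using nn by (subst (asm) sum_nonneg_eq_0_iff) auto
    then show "z = 0"
      using assms by (metis less_irrefl mult_eq_0_iff vec_eq_iff zero_index)
  qed
  then show ?thesis
    by (force simp: demand_def is_arg_max_def)
qed

text \<open>Money buys value at rate at most \<open>1 / l\<close>, hence net gain at rate at most
  \<open>1 / l - 1\<close>, which is nonnegative. The bundle \<open>x\<close> attains this rate on
  all it spends, and by \<open>slack\<close> any unspent money loses nothing.\<close>

lemma in_demand_of_slope:
  assumes b: "0 < b" and x: "\<And>i. 0 \<le> x $ i"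
    and le: "\<And>i. budget_slope b (v \<bullet> x) * v $ i \<le> p $ i"
    and eq: "\<And>i. budget_slope b (v \<bullet> x) * v $ i * x $ i = p $ i * x $ i"
  shows "x \<in> demand b v p"
proof -
  define l where "l = budget_slope b (v \<bullet> x)"
  have l: "0 < l" "l \<le> 1"
    using budget_slope_pos[OF b] budget_slope_le_1[OF b] by (auto simp: l_def)
  have px: "p \<bullet> x = l * (v \<bullet> x)"
    unfolding inner_vec_def sum_distrib_left inner_real_def
    by (intro sum.cong refl) (metis eq l_def mult.assoc)
  have spent: "p \<bullet> x \<le> b"
    using b unfolding px l_def budget_slope_def by (simp add: field_simps max_def)
  \<comment> \<open>If \<open>b \<le> v \<bullet> x\<close> the whole budget is spent; otherwise
    \<open>l = 1\<close> and both sides vanish.\<close>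
  have slack: "(1 / l - 1) * (p \<bullet> x) = (1 / l - 1) * b"
    using b unfolding px l_def budget_slope_def by (simp add: max_def)
  have "(v - p) \<bullet> z \<le> (v - p) \<bullet> x" if z: "\<forall>i. 0 \<le> z $ i" "p \<bullet> z \<le> b" for z
  proof -
    have "l * (v \<bullet> z) \<le> p \<bullet> z"
      unfolding inner_vec_def sum_distrib_left
      by (rule sum_mono) (use le z in \<open>auto simp: l_def mult.assoc[symmetric] intro!: mult_right_mono\<close>)
    then have "(v - p) \<bullet> z \<le> (1 / l - 1) * (p \<bullet> z)"
      using l by (simp add: inner_diff_left field_simps)
    also have "\<dots> \<le> (1 / l - 1) * b"
      using z l by (intro mult_left_mono) auto
    also have "\<dots> = (v - p) \<bullet> x"
      using l unfolding slack[symmetric] px by (simp add: inner_diff_left px field_simps)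
    finally show ?thesis .
  qed
  then show ?thesis
    using x spent by (auto simp: demand_def is_arg_max_def not_less)
qed

text \<open>The equilibrium argument for general convex costs on a box, separated from the stepwise
  form. Prices are the highest linearised marginal values.\<close>

lemma exists_equilibrium_convex_cost:
  fixes v :: "'b \<Rightarrow> real ^ 'n" and D :: "'n \<Rightarrow> real \<Rightarrow> real"
  assumes fin: "finite J" and b: "\<And>j. j \<in> J \<Longrightarrow> 0 < b j"
    and v: "\<And>i. \<exists>j\<in>J. 0 < v j $ i"
    and cap: "\<And>i. 0 \<le> cap i"
    and cont: "\<And>i. continuous_on {0..cap i} (D i)"
    and conv: "\<And>i. convex_on {0..cap i} (D i)"
  obtains p x where "\<And>i. 0 < p $ i" "x \<in> feasible_allocations J cap"
    "\<And>j. j \<in> J \<Longrightarrow> x j \<in> demand (b j) (v j) p"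
    "\<And>z. (\<And>i. z $ i \<in> {0..cap i}) \<Longrightarrow>
      p \<bullet> z - (\<Sum>i\<in>UNIV. D i (z $ i)) \<le> p \<bullet> (\<Sum>j\<in>J. x j) - (\<Sum>i\<in>UNIV. D i ((\<Sum>j\<in>J. x j) $ i))"
proof -
  let ?F = "feasible_allocations J cap"
  obtain x where x: "x \<in> ?F" and opt: "\<And>z. z \<in> ?F \<Longrightarrow>
      (\<Sum>j\<in>J. budget_slope (b j) (v j \<bullet> x j) * (v j \<bullet> z j)) - (\<Sum>i\<in>UNIV. D i (\<Sum>j\<in>J. z j $ i)) \<le>
      (\<Sum>j\<in>J. budget_slope (b j) (v j \<bullet> x j) * (v j \<bullet> x j)) - (\<Sum>i\<in>UNIV. D i (\<Sum>j\<in>J. x j $ i))"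
    by (rule exists_linearised_optimum[of J b cap D v]) (use fin b cap cont conv that in blast)+
  define l where "l j = budget_slope (b j) (v j \<bullet> x j)" for j
  define y where "y = (\<Sum>j\<in>J. x j)"
  have x0: "\<And>j i. 0 \<le> x j $ i" and y: "\<And>i. y $ i \<in> {0..cap i}"
    using x feasible_allocations_sum[OF x] by (auto simp: feasible_allocations_def y_def)
  have "J \<noteq> {}" using v by auto
  then have "\<exists>j\<in>J. \<forall>k\<in>J. l k * v k $ i \<le> l j * v j $ i" for i
  proof -
    have "Max ((\<lambda>j. l j * v j $ i) ` J) \<in> (\<lambda>j. l j * v j $ i) ` J"
      using fin \<open>J \<noteq> {}\<close> by (intro Max_in) auto
    then obtain j where j: "j \<in> J" "Max ((\<lambda>j. l j * v j $ i) ` J) = l j * v j $ i"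
      by blast
    have "l k * v k $ i \<le> l j * v j $ i" if "k \<in> J" for k
      unfolding j(2)[symmetric] using fin that by (intro Max_ge) auto
    with j(1) show ?thesis by blast
  qed
  then obtain best where best: "\<And>i. best i \<in> J"
      "\<And>i k. k \<in> J \<Longrightarrow> l k * v k $ i \<le> l (best i) * v (best i) $ i"
    by metis
  define p :: "real ^ 'n" where "p = (\<chi> i. l (best i) * v (best i) $ i)"
  have le: "l k * v k $ i \<le> p $ i" if "k \<in> J" for k i
    using best(2)[OF that] by (simp add: p_def)
  have p: "0 < p $ i" for i
  proof -
    obtain j where j: "j \<in> J" "0 < v j $ i" using v by auto
    then have "0 < l j * v j $ i"
      using b by (simp add: l_def budget_slope_pos)
    then show ?thesis using le[OF j(1), of i] by simp
  qed
  have main: "p \<bullet> z - (\<Sum>i\<in>UNIV. D i (z $ i)) \<le>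
      (\<Sum>j\<in>J. l j * (v j \<bullet> x j)) - (\<Sum>i\<in>UNIV. D i (y $ i))"
    if z: "\<And>i. z $ i \<in> {0..cap i}" for z
  proof -
    \<comment> \<open>Each good goes entirely to a bid that sets its price, so the linearised value
      of \<open>z'\<close> is exactly \<open>p \<bullet> z\<close>.\<close>
    define z' :: "'b \<Rightarrow> real ^ 'n" where "z' j = (\<chi> i. if j = best i then z $ i else 0)" for j
    have sum: "(\<Sum>j\<in>J. z' j $ i) = z $ i" for i
      using fin best(1) by (simp add: z'_def)
    have "z' \<in> ?F"
      unfolding feasible_allocations_def mem_Collect_eq sum
      using z best(1) by (auto simp: z'_def vec_eq_iff)
    moreover have "(\<Sum>j\<in>J. l j * (v j \<bullet> z' j)) = p \<bullet> z"
    proof -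
      have "(\<Sum>j\<in>J. l j * (v j \<bullet> z' j)) = (\<Sum>j\<in>J. \<Sum>i\<in>UNIV. if j = best i then p $ i * z $ i else 0)"
        unfolding inner_vec_def sum_distrib_left
        by (intro sum.cong refl) (simp add: z'_def p_def)
      also have "\<dots> = p \<bullet> z"
        using fin best(1) by (subst sum.swap) (simp add: inner_vec_def)
      finally show ?thesis .
    qed
    ultimately show ?thesis
      using opt[of z'] by (simp add: sum l_def y_def)
  qed
  have py: "p \<bullet> y = (\<Sum>j\<in>J. \<Sum>i\<in>UNIV. p $ i * x j $ i)"
    unfolding y_def inner_sum_right by (simp add: inner_vec_def)
  have lx: "(\<Sum>j\<in>J. l j * (v j \<bullet> x j)) = (\<Sum>j\<in>J. \<Sum>i\<in>UNIV. l j * v j $ i * x j $ i)"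
    by (simp add: inner_vec_def sum_distrib_left mult.assoc)
  have nn: "0 \<le> p $ i * x j $ i - l j * v j $ i * x j $ i" if "j \<in> J" for i j
    using le[OF that, of i] x0 by (simp add: mult_right_mono)
  \<comment> \<open>Taking \<open>z = y\<close> in \<open>main\<close> cancels the costs and bounds
    this sum of nonnegative terms by 0.\<close>
  have "(\<Sum>j\<in>J. \<Sum>i\<in>UNIV. p $ i * x j $ i - l j * v j $ i * x j $ i) = 0"
    using main[of y] y nn py lx by (intro antisym sum_nonneg) (auto simp: sum_subtractf)
  then have "\<forall>j\<in>J. \<forall>i. p $ i * x j $ i - l j * v j $ i * x j $ i = 0"
    using nn fin by (simp add: sum_nonneg_eq_0_iff sum_nonneg)
  then have eq: "l j * v j $ i * x j $ i = p $ i * x j $ i" if "j \<in> J" for j i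
    using that by (metis eq_iff_diff_eq_0)
  have "x j \<in> demand (b j) (v j) p" if "j \<in> J" for j
    by (rule in_demand_of_slope) (use b that x0 le[OF that] eq[OF that] in \<open>auto simp: l_def\<close>)
  \<comment> \<open>With this equality \<open>main\<close> becomes profit maximisation at the prices
    \<open>p\<close>.\<close>
  moreover have "(\<Sum>j\<in>J. l j * (v j \<bullet> x j)) = p \<bullet> y"
    using eq unfolding py lx by (intro sum.cong refl) auto
  ultimately show thesis
    using that[of p x] p x main by (simp add: y_def)
qed

section \<open>Return to stepwise costs and to all bids\<close>

lemma total_cost_eq_infinity:
  assumes "cum_width (s i) (K i) < z $ i"
  shows "total_cost K s c z = \<infinity>"
  unfolding total_cost_def sum_Pinfty using assms by (auto simp: step_cost_def intro!: exI[of _ i])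

theorem corollary1:
  fixes m :: nat
    and \<beta> :: "nat \<Rightarrow> real"
    and r :: "nat \<Rightarrow> real ^ 'n"
    and K :: "'n \<Rightarrow> nat"
    and s c :: "'n \<Rightarrow> nat \<Rightarrow> real"
  assumes "arctic_auction m \<beta> r K s c"
    and "\<forall>j\<in>{1..m}. \<exists>i. 0 < r j $ i"
    and "\<forall>i. \<exists>j\<in>{1..m}. 0 < \<beta> j \<and> 0 < r j $ i"
  shows "\<exists>p x. competitive_equilibrium m \<beta> r K s c p x"
proof -
  interpret arctic_auction m \<beta> r K s c by fact
  \<comment> \<open>The logarithmic utility needs a positive budget. The assumption on goods
    survives the restriction, since its witnesses have positive budgets.\<close>
  define J where "J = {j \<in> {1..m}. 0 < \<beta> j}"
  define cap where "cap i = cum_width (s i) (K i)" for i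
  define D where "D i = real_step_cost (K i) (s i) (c i)" for i
  note cost_facts = width_pos strict_mono_on_imp_mono_on[OF marginal_increasing] steps_pos
  have cap: "0 \<le> cap i" for i
    using width_pos by (auto simp: cap_def cum_width_def less_imp_le intro!: sum_nonneg)
  obtain p x where p: "\<And>i. 0 < p $ i" and x: "x \<in> feasible_allocations J cap"
    and dem: "\<And>j. j \<in> J \<Longrightarrow> x j \<in> demand (\<beta> j) (r j) p"
    and sup: "\<And>z. (\<And>i. z $ i \<in> {0..cap i}) \<Longrightarrow>
      p \<bullet> z - (\<Sum>i\<in>UNIV. D i (z $ i)) \<le> p \<bullet> (\<Sum>j\<in>J. x j) - (\<Sum>i\<in>UNIV. D i ((\<Sum>j\<in>J. x j) $ i))"
  proof (rule exists_equilibrium_convex_cost[of J \<beta> r cap D])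
    show "continuous_on {0..cap i} (D i)" for i
      unfolding cap_def D_def by (rule continuous_on_real_step_cost[OF cost_facts])
    show "convex_on {0..cap i} (D i)" for i
      unfolding cap_def D_def by (rule convex_on_real_step_cost[OF cost_facts])
    show "\<exists>j\<in>J. 0 < r j $ i" for i
      using assms(3) unfolding J_def by blast
  qed (use cap in \<open>auto simp: J_def\<close>)
  have x0: "x j = 0" if "j \<notin> J" for j
    using x that by (auto simp: feasible_allocations_def)
  define y where "y = (\<Sum>j\<in>J. x j)"
  have y_eq: "(\<Sum>j=1..m. x j) = y"
    unfolding y_def by (rule sum.mono_neutral_right) (use x0 in \<open>auto simp: J_def\<close>)
  have y: "y $ i \<in> {0..cap i}" for i
    using feasible_allocations_sum[OF x] by (simp add: y_def)
  have total: "total_cost K s c z = ereal (\<Sum>i\<in>UNIV. D i (z $ i))" if "\<And>i. z $ i \<in> {0..cap i}" for z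
    using that unfolding total_cost_def D_def cap_def
    by (subst sum_ereal[symmetric]) (intro sum.cong refl step_cost_eq_real[OF cost_facts])
  \<comment> \<open>Within the caps all costs are real and \<open>sup\<close> applies; beyond a cap
    the profit is minus infinity.\<close>
  have "ereal (p \<bullet> z) - total_cost K s c z \<le> ereal (p \<bullet> y) - total_cost K s c y"
    if z: "\<forall>i. 0 \<le> z $ i" for z
  proof (cases "\<forall>i. z $ i \<le> cap i")
    case True
    then have "\<And>i. z $ i \<in> {0..cap i}" using z by auto
    from sup[OF this] total[OF this] show ?thesis
      unfolding y_def[symmetric] by (simp add: total[OF y])
  next
    case False
    then have "total_cost K s c z = \<infinity>"
      by (auto simp: cap_def not_le intro: total_cost_eq_infinity)
    then show ?thesis by simp
  qed
  then have "is_arg_max (\<lambda>z. ereal (p \<bullet> z) - total_cost K s c z) (\<lambda>z. \<forall>i. 0 \<le> z $ i) y"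
    using y by (auto simp: is_arg_max_def not_less)
  moreover have "x j \<in> demand (\<beta> j) (r j) p" if "j \<in> {1..m}" for j
  proof (cases "j \<in> J")
    case False
    then have "\<beta> j = 0" using budget_nonneg[OF that] that by (auto simp: J_def)
    then show ?thesis using zero_in_demand_0[of p] p x0[OF False] by simp
  qed (rule dem)
  ultimately have "competitive_equilibrium m \<beta> r K s c p x"
    unfolding competitive_equilibrium_def y_eq using p by auto
  then show ?thesis by blast
qed

end
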